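(* Let $m,n,M$ be the library size, the number of users and the cache size per user (in files), respectively, in a single-hop wireless D2D caching network with transmission range $r$. Let $t=nM/m$. If $r\ge\sqrt2$, $n=(m/M)^2$, $m/M\in\mathbb{Z}^+$ and $t\ge 2$, then the transmission rate $$R^{\rm hc}(M)=\frac{m}{M}$$ is achievable with each file split into $$K=K^{\rm hc}=\sqrt{n}^{\,\sqrt{n}}$$ packets.
   Context: Network. Users $\mathcal{U}=\{0,\dots,n-1\}$ lie on a uniform grid in the unit square. A library of $m\ge n$ independent files $W_f$, $f\in\mathcal{F}$, $|\mathcal{F}|=m$, of $F$ bits (entropy $F$) each is given. Each user has a cache of $MF$ bits. User $u$ requests a file $f_u\in\mathcal{F}$; demands are arbitrary (users request distinct files), with demand vector $\mathsf f=(f_0,\dots,f_{n-1})$. When $r\ge\sqrt2$ every transmission by any user can be received by all other users, so every user hears all transmitted messages. Scheme with $K$ packets per file. Each file is split into $K$ packets of equal size $F/K$ bits. (i) Cache placement (done before, and independently of, the demands): user $u$ stores $MK$ of the $mK$ packets; call its content $Z_u$. (ii) Delivery: knowing $\mathsf f$, user $u$ broadcasts a message $X_{u,\mathsf f}$ of $R_uF$ bits that is a function of $Z_u$ and $\mathsf f$ only, consisting of codewords of size $F/K$ bits, each a bitwise XOR of packets stored in $Z_u$. (iii) Decoding: user $u$ produces an estimate $\hat W_{u,\mathsf f}$ of $W_{f_u}$ from the messages it receives from the other users, $Z_u$ and $\mathsf f$. The transmission rate is $R=\sum_{u\in\mathcal{U}}R_u$. The rate $R$ is achievable for cache size $M$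 if for every $\varepsilon>0$ there is a sequence of such schemes, indexed by $F\to\infty$, with rates $R^{(F)}$ and worst-case error probabilities $P_e^{(F)}=\max_{\mathsf f}\max_u\Pr(\hat W_{u,\mathsf f}\ne W_{f_u})$ satisfying $\limsup R^{(F)}\le R$ and $\limsup P_e^{(F)}\le\varepsilon$. *)

theory Defs
  imports "HOL-Probability.Probability"
begin

text \<open>Users are \<open>{..<n}\<close> and files are \<open>{..<m}\<close>. Every spacing, offset and numbering of the grid is
  admitted, so all usual conventions for the grid are covered.\<close>

definition uniform_grid :: "nat \<Rightarrow> (nat \<Rightarrow> real \<times> real) \<Rightarrow> bool" where
  "uniform_grid n pos \<longleftrightarrow>
     (\<exists>(s::nat) x y \<delta>. s * s = n \<and> 0 < \<delta> \<and>
        bij_betw pos {..<n}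
          ((\<lambda>(i, j). (x + real i * \<delta>, y + real j * \<delta>)) ` ({..<s} \<times> {..<s}))) \<and>
     pos ` {..<n} \<subseteq> {0..1} \<times> {0..1}"

definition bit_strings :: "nat \<Rightarrow> bool list set" where
  "bit_strings F = {w. length w = F}"

definition file_library ::
    "nat \<Rightarrow> nat \<Rightarrow> 'w measure \<Rightarrow> (nat \<Rightarrow> 'w \<Rightarrow> bool list) \<Rightarrow> bool" where
  "file_library m F P W \<longleftrightarrow>
     prob_space P \<and>
     prob_space.indep_vars P (\<lambda>_. count_space (bit_strings F)) W {..<m} \<and>
     (\<forall>f<m. prob_space.entropy P 2 (count_space (bit_strings F)) (W f) = real F)"

definition demands :: "nat \<Rightarrow> nat \<Rightarrow> (nat \<Rightarrow> nat) set" where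
  "demands n m = {d \<in> {..<n} \<rightarrow>\<^sub>E {..<m}. inj_on d {..<n}}"

text \<open>The pair \<open>(f, k)\<close> names the \<open>k\<close>-th of the \<open>K\<close> packets of file \<open>f\<close>.\<close>

type_synonym packet_id = "nat \<times> nat"
type_synonym packet = "bool list"
type_synonym cache = "packet_id \<Rightarrow> packet option"
type_synonym message = "packet list"

definition packet_of :: "nat \<Rightarrow> nat \<Rightarrow> (nat \<Rightarrow> bool list) \<Rightarrow> packet_id \<Rightarrow> packet" where
  "packet_of K F w = (\<lambda>(f, k). take (F div K) (drop (k * (F div K)) (w f)))"

text \<open>Bitwise XOR of the packets in \<open>A\<close>, computed from the cache content: a bit is set iff it is set
  in an odd number of these packets.\<close>

definition xor_packets :: "nat \<Rightarrow> cache \<Rightarrow> packet_id set \<Rightarrow> packet" where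
  "xor_packets b Z A = map (\<lambda>i. odd (card {p \<in> A. the (Z p) ! i})) [0..<b]"

text \<open>\<open>codewords S u d\<close> lists, for each codeword that user \<open>u\<close> broadcasts under the demand vector \<open>d\<close>,
  the packets that are XORed. The decoder sees the demand vector, the own cache content and the
  received messages (\<open>None\<close> where nothing is received), and nothing else.\<close>

record scheme =
  placement :: "nat \<Rightarrow> packet_id set"
  codewords :: "nat \<Rightarrow> (nat \<Rightarrow> nat) \<Rightarrow> packet_id set list"
  user_rate :: "nat \<Rightarrow> real"
  decoder :: "nat \<Rightarrow> (nat \<Rightarrow> nat) \<Rightarrow> cache \<Rightarrow> (nat \<Rightarrow> message option) \<Rightarrow> bool list"

definition valid_scheme :: "nat \<Rightarrow> nat \<Rightarrow> real \<Rightarrow> nat \<Rightarrow> nat \<Rightarrow> scheme \<Rightarrow> bool" where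
  "valid_scheme n m M K F S \<longleftrightarrow>
     (\<forall>u<n. placement S u \<subseteq> {..<m} \<times> {..<K} \<and>
            real (card (placement S u)) = M * real K \<and>
            (\<forall>d\<in>demands n m.
               (\<forall>A\<in>set (codewords S u d). A \<subseteq> placement S u) \<and>
               real (length (codewords S u d)) * (real F / real K) = user_rate S u * real F))"

definition cache_content ::
    "nat \<Rightarrow> nat \<Rightarrow> scheme \<Rightarrow> (nat \<Rightarrow> bool list) \<Rightarrow> nat \<Rightarrow> cache" where
  "cache_content K F S w u =
     (\<lambda>p. if p \<in> placement S u then Some (packet_of K F w p) else None)"

definition sent_message ::
    "nat \<Rightarrow> nat \<Rightarrow> scheme \<Rightarrow> (nat \<Rightarrow> nat) \<Rightarrow> cache \<Rightarrow> nat \<Rightarrow> message" where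
  "sent_message K F S d Z u = map (xor_packets (F div K) Z) (codewords S u d)"

definition received ::
    "nat \<Rightarrow> (nat \<Rightarrow> real \<times> real) \<Rightarrow> real \<Rightarrow> nat \<Rightarrow> nat \<Rightarrow> scheme \<Rightarrow> (nat \<Rightarrow> nat)
      \<Rightarrow> (nat \<Rightarrow> bool list) \<Rightarrow> nat \<Rightarrow> nat \<Rightarrow> message option" where
  "received n pos r K F S d w u =
     (\<lambda>v. if v < n \<and> v \<noteq> u \<and> dist (pos u) (pos v) \<le> r
          then Some (sent_message K F S d (cache_content K F S w v) v) else None)"

definition estimate ::
    "nat \<Rightarrow> (nat \<Rightarrow> real \<times> real) \<Rightarrow> real \<Rightarrow> nat \<Rightarrow> nat \<Rightarrow> scheme \<Rightarrow> (nat \<Rightarrow> nat)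
      \<Rightarrow> (nat \<Rightarrow> bool list) \<Rightarrow> nat \<Rightarrow> bool list" where
  "estimate n pos r K F S d w u =
     decoder S u d (cache_content K F S w u) (received n pos r K F S d w u)"

definition total_rate :: "nat \<Rightarrow> scheme \<Rightarrow> real" where
  "total_rate n S = (\<Sum>u<n. user_rate S u)"

definition error_prob ::
    "'w measure \<Rightarrow> (nat \<Rightarrow> 'w \<Rightarrow> bool list) \<Rightarrow> nat \<Rightarrow> nat \<Rightarrow> (nat \<Rightarrow> real \<times> real) \<Rightarrow> real
      \<Rightarrow> nat \<Rightarrow> nat \<Rightarrow> scheme \<Rightarrow> real" where
  "error_prob P W n m pos r K F S =
     (MAX d\<in>demands n m. MAX u\<in>{..<n}.
        measure P {\<omega> \<in> space P. estimate n pos r K F S d (\<lambda>f. W f \<omega>) u \<noteq> W (d u) \<omega>})"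

text \<open>Packets have \<open>F / K\<close> bits, so \<open>F\<close> tends to infinity along the multiples of \<open>K\<close>.\<close>

definition file_sizes :: "nat \<Rightarrow> nat filter" where
  "file_sizes K = inf at_top (principal {F. K dvd F})"

text \<open>\<open>P F\<close> and \<open>W F\<close> are the probability space and the library for files of \<open>F\<close> bits.\<close>

definition achievable ::
    "(nat \<Rightarrow> 'w measure) \<Rightarrow> (nat \<Rightarrow> nat \<Rightarrow> 'w \<Rightarrow> bool list) \<Rightarrow> nat \<Rightarrow> nat
      \<Rightarrow> (nat \<Rightarrow> real \<times> real) \<Rightarrow> real \<Rightarrow> nat \<Rightarrow> real \<Rightarrow> real \<Rightarrow> bool" where
  "achievable P W n m pos r K M R \<longleftrightarrow>
     0 < K \<and>
     (\<forall>\<epsilon>>0. \<exists>S :: nat \<Rightarrow> scheme.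
        (\<forall>F>0. K dvd F \<longrightarrow> valid_scheme n m M K F (S F)) \<and>
        Limsup (file_sizes K) (\<lambda>F. ereal (total_rate n (S F))) \<le> ereal R \<and>
        Limsup (file_sizes K) (\<lambda>F. ereal (error_prob (P F) (W F) n m pos r K F (S F))) \<le> ereal \<epsilon>)"

end

theory Submission
  imports Defs
begin

text \<open>Put \<open>q = m / M\<close>, so that \<open>n = q\<^sup>2\<close> and \<open>t = q\<close>. Number the users by pairs \<open>(i, c)\<close> and the
  \<open>q ^ q\<close> packets of a file by the points of the cube \<open>{0..<q} ^ q\<close>; user \<open>(i, c)\<close> caches the packets
  whose \<open>i\<close>-th coordinate is \<open>c\<close>, for every file. A point \<open>a\<close> of the cube is also a group of \<open>q\<close> users
  \<open>(i, a i)\<close>, in which user \<open>(i, a i)\<close> wants the points that differ from \<open>a\<close> in coordinate \<open>i\<close> only.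
  Member \<open>j\<close> of the group broadcasts the XOR over \<open>i\<close> of the packet that member \<open>i\<close> wants at the
  point obtained from \<open>a\<close> by adding \<open>j - i\<close> modulo \<open>q\<close> to the coordinate \<open>i\<close>. Member \<open>i\<close> has cached all
  the other summands, and as \<open>j\<close> runs over the other members it obtains all its \<open>q - 1\<close> missing
  packets. Every user sends \<open>q ^ (q - 1)\<close> codewords of relative size \<open>1 / q ^ q\<close>, which gives
  the total rate \<open>q\<^sup>2 / q = q\<close>. The decoder outputs the wanted file of an arbitrary library that is
  consistent with everything the user sees; it suffices that all such libraries agree on this file.\<close>

section \<open>Decoding by consistency\<close>

text \<open>Caches and messages depend only on \<open>placement\<close> and
  \<open>codewords\<close>, so consistency is tested against the old \<open>S\<close> without
  circularity.\<close>

definition with_consistent_decoder ::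
    "nat \<Rightarrow> (nat \<Rightarrow> real \<times> real) \<Rightarrow> real \<Rightarrow> nat \<Rightarrow> nat \<Rightarrow> nat \<Rightarrow> scheme \<Rightarrow> scheme" where
  "with_consistent_decoder n pos r m K F S =
     S\<lparr>decoder := \<lambda>u d Z Y.
         (SOME w. (\<forall>f<m. length (w f) = F) \<and> cache_content K F S w u = Z \<and>
                  received n pos r K F S d w u = Y) (d u)\<rparr>"

lemma with_consistent_decoder_simps [simp]:
  "placement (with_consistent_decoder n pos r m K F S) = placement S"
  "codewords (with_consistent_decoder n pos r m K F S) = codewords S"
  "user_rate (with_consistent_decoder n pos r m K F S) = user_rate S"
  by (simp_all add: with_consistent_decoder_def)

text \<open>The true \<open>w\<close> is itself consistent, so \<open>SOME\<close> has a witness;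
  the chosen library may differ from \<open>w\<close> on files other than
  \<open>d u\<close>.\<close>

lemma estimate_with_consistent_decoder:
  assumes len: "\<forall>f<m. length (w f) = F"
    and unique: "\<And>w'. \<forall>f<m. length (w' f) = F \<Longrightarrow>
        cache_content K F S w' u = cache_content K F S w u \<Longrightarrow>
        received n pos r K F S d w' u = received n pos r K F S d w u \<Longrightarrow> w' (d u) = w (d u)"
  shows "estimate n pos r K F (with_consistent_decoder n pos r m K F S) d w u = w (d u)"
proof -
  let ?S = "with_consistent_decoder n pos r m K F S"
  let ?Q = "\<lambda>w'. (\<forall>f<m. length (w' f) = F) \<and> cache_content K F S w' u = cache_content K F S w u \<and>
              received n pos r K F S d w' u = received n pos r K F S d w u"
  have cache: "cache_content K F ?S = cache_content K F S"
    by (simp add: fun_eq_iff cache_content_def)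
  have rec: "received n pos r K F ?S d w u = received n pos r K F S d w u"
    by (simp add: fun_eq_iff received_def sent_message_def cache)
  have "?Q (SOME w'. ?Q w')"
    by (rule someI[of ?Q w]) (use len in simp)
  then have "(SOME w'. ?Q w') (d u) = w (d u)"
    using unique by blast
  moreover have "decoder ?S u d Z Y = (SOME w'. (\<forall>f<m. length (w' f) = F) \<and>
      cache_content K F S w' u = Z \<and> received n pos r K F S d w' u = Y) (d u)" for Z Y
    by (simp add: with_consistent_decoder_def)
  ultimately show ?thesis
    by (simp only: estimate_def cache rec)
qed

section \<open>Packets and XORs\<close>

lemma length_packet_of:
  assumes "K dvd F" "k < K" "length (w f) = F"
  shows "length (packet_of K F w (f, k)) = F div K"
proof -
  have "(k + 1) * (F div K) \<le> K * (F div K)"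
    using assms(2) by (intro mult_right_mono) auto
  then have "k * (F div K) + F div K \<le> F"
    using assms(1) by (simp add: algebra_simps)
  then show ?thesis
    using assms(3) by (simp add: packet_of_def)
qed

lemma file_eqI_packets:
  assumes "K dvd F" "length (w f) = F" "length (w' f) = F"
    and "\<And>k. k < K \<Longrightarrow> packet_of K F w (f, k) = packet_of K F w' (f, k)"
  shows "w f = w' f"
proof (rule nth_equalityI)
  show "length (w f) = length (w' f)"
    using assms by simp
  fix i assume "i < length (w f)"
  then have i: "i < F"
    using assms by simp
  define b where "b = F div K"
  have F: "F = K * b"
    using assms(1) by (simp add: b_def)
  have b: "0 < b"
    using i F by (cases b) auto
  have k: "i div b < K"
    using i F b by (simp add: less_mult_imp_div_less)
  \<comment> \<open>Bit \<open>i\<close> of a file is bit \<open>i mod b\<close> of its packet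
    \<open>i div b\<close>.\<close>
  have nth: "take b (drop (i div b * b) x) ! (i mod b) = x ! i" if "length x = F" for x :: "bool list"
  proof -
    have "i div b * b \<le> length x"
      using that i div_times_less_eq_dividend[of i b] by linarith
    then show ?thesis
      using b by simp
  qed
  show "w f ! i = w' f ! i"
    using assms(4)[OF k] nth[OF assms(2)] nth[OF assms(3)] by (simp add: packet_of_def b_def)
qed

text \<open>Away from \<open>p\<close> the two counted sets coincide, so disagreement at
  \<open>p\<close> would make the counts differ by exactly one.\<close>

lemma parity_determines_summand:
  assumes "finite A" "p \<in> A" "\<And>x. x \<in> A - {p} \<Longrightarrow> P x = Q x"
    and parity: "odd (card {x \<in> A. P x}) = odd (card {x \<in> A. Q x})"
  shows "P p = Q p"
proof -
  define B where "B = {x \<in> A - {p}. P x}"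
  have B: "finite B" "p \<notin> B"
    using assms(1) by (auto simp: B_def)
  have "{x \<in> A. P x} = (if P p then insert p B else B)"
    "{x \<in> A. Q x} = (if Q p then insert p B else B)"
    using assms(2,3) by (auto simp: B_def)
  then show ?thesis
    using parity B by (auto split: if_splits)
qed

text \<open>\<open>Z\<close> and \<open>Z'\<close> are meant as the sender's cache under two
  candidate libraries; the parity argument is applied bit by bit.\<close>

lemma xor_packets_determines_summand:
  assumes A: "finite A" "p \<in> A"
    and others: "\<And>x. x \<in> A - {p} \<Longrightarrow> Z x = Z' x"
    and len: "length (the (Z p)) = b" "length (the (Z' p)) = b"
    and xor: "xor_packets b Z A = xor_packets b Z' A"
  shows "the (Z p) = the (Z' p)"
proof (rule nth_equalityI)
  show "length (the (Z p)) = length (the (Z' p))"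
    using len by simp
  fix i assume "i < length (the (Z p))"
  then have "odd (card {x \<in> A. the (Z x) ! i}) = odd (card {x \<in> A. the (Z' x) ! i})"
    using xor len by (simp add: xor_packets_def)
  then show "the (Z p) ! i = the (Z' p) ! i"
    using others
    by (intro parity_determines_summand[OF A, of "\<lambda>x. the (Z x) ! i" "\<lambda>x. the (Z' x) ! i"]) simp_all
qed

section \<open>The hypercube scheme\<close>

definition cube :: "nat \<Rightarrow> (nat \<Rightarrow> nat) set" where
  "cube q = {..<q} \<rightarrow>\<^sub>E {..<q}"

text \<open>User \<open>u\<close> stands for the pair \<open>(u div q, u mod q)\<close>.\<close>

definition slab :: "nat \<Rightarrow> nat \<Rightarrow> (nat \<Rightarrow> nat) set" where
  "slab q u = {a \<in> cube q. a (u div q) = u mod q}"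

lemma finite_cube: "finite (cube q)"
  by (simp add: cube_def finite_PiE)

lemma card_cube: "card (cube q) = q ^ q"
  by (simp add: cube_def card_PiE)

lemma finite_slab: "finite (slab q u)"
  using finite_cube by (simp add: slab_def)

lemma cube_upd: "a \<in> cube q \<Longrightarrow> i < q \<Longrightarrow> c < q \<Longrightarrow> a(i := c) \<in> cube q"
  by (auto simp: cube_def PiE_iff extensional_def)

lemma card_cube_section:
  assumes "i < q" "c < q"
  shows "card {a \<in> cube q. a i = c} = q ^ (q - 1)"
proof -
  let ?B = "\<lambda>j. if j = i then {c} else {..<q}"
  \<comment> \<open>Fixing a coordinate gives again a product set, with factor \<open>i\<close>
    shrunk to one point.\<close>
  have "(\<forall>j\<in>{..<q}. a j \<in> ?B j) \<longleftrightarrow> (\<forall>j\<in>{..<q}. a j \<in> {..<q}) \<and> a i = c" for a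
    using assms by (metis (full_types) lessThan_iff singleton_iff)
  then have "a \<in> cube q \<and> a i = c \<longleftrightarrow> a \<in> PiE {..<q} ?B" for a
    unfolding cube_def PiE_iff by metis
  then have "{a \<in> cube q. a i = c} = PiE {..<q} ?B"
    by (simp only: set_eq_iff mem_Collect_eq simp_thms)
  then have "card {a \<in> cube q. a i = c} = (\<Prod>j\<in>{..<q}. card (?B j))"
    by (simp only: card_PiE finite_lessThan)
  also have "\<dots> = card (?B i) * (\<Prod>j\<in>{..<q} - {i}. card (?B j))"
    using assms(1) by (intro prod.remove) auto
  also have "(\<Prod>j\<in>{..<q} - {i}. card (?B j)) = (\<Prod>j\<in>{..<q} - {i}. q)"
    by (rule prod.cong) auto
  finally show ?thesis
    using assms(1) by simp
qed

lemma card_slab: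
  assumes "u < q * q"
  shows "card (slab q u) = q ^ (q - 1)"
proof -
  have "0 < q"
    using assms by (cases "q = 0") auto
  then show ?thesis
    unfolding slab_def using less_mult_imp_div_less[OF assms] by (intro card_cube_section) simp_all
qed

text \<open>The \<open>i\<close>-th coordinate is shifted by \<open>u div q - i\<close>, with \<open>q\<close> added to avoid truncation.\<close>

definition hc_codeword ::
    "nat \<Rightarrow> ((nat \<Rightarrow> nat) \<Rightarrow> nat) \<Rightarrow> (nat \<Rightarrow> nat) \<Rightarrow> nat \<Rightarrow> (nat \<Rightarrow> nat) \<Rightarrow> packet_id set" where
  "hc_codeword q e d u a =
     (\<lambda>i. (d (i * q + a i), e (a(i := (a i + u div q + (q - i)) mod q)))) ` {..<q}"

text \<open>Codewords must form a list, so the slab is enumerated by its sorted packet numbers, each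
  mapped back to its point. The decoder is left open for \<open>with_consistent_decoder\<close> to
  fill.\<close>

definition hc_scheme :: "nat \<Rightarrow> nat \<Rightarrow> ((nat \<Rightarrow> nat) \<Rightarrow> nat) \<Rightarrow> scheme" where
  "hc_scheme m q e =
     \<lparr>placement = (\<lambda>u. {..<m} \<times> e ` slab q u),
      codewords = (\<lambda>u d. map (\<lambda>k. hc_codeword q e d u (inv_into (cube q) e k))
                             (sorted_list_of_set (e ` slab q u))),
      user_rate = (\<lambda>u. 1 / real q),
      decoder = undefined\<rparr>"

locale hypercube =
  fixes q m :: nat and e :: "(nat \<Rightarrow> nat) \<Rightarrow> nat"
  assumes q_pos: "0 < q"
    and numbering: "bij_betw e (cube q) {..<q ^ q}"
begin

lemma card_image_slab:
  assumes "u < q * q"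
  shows "card (e ` slab q u) = q ^ (q - 1)"
proof -
  have "inj_on e (slab q u)"
    using numbering by (auto simp: slab_def bij_betw_def intro: inj_on_subset)
  then show ?thesis
    by (simp only: card_image card_slab[OF assms])
qed

lemma user_pair_less: "i < q \<Longrightarrow> c < q \<Longrightarrow> i * q + c < q * q"
proof -
  assume "i < q" "c < q"
  then have "i * q + c < (i + 1) * q" by simp
  also have "\<dots> \<le> q * q" using \<open>i < q\<close> by (intro mult_right_mono) auto
  finally show ?thesis .
qed

lemma demand_less: "d \<in> demands (q * q) m \<Longrightarrow> u < q * q \<Longrightarrow> d u < m"
  by (auto simp: demands_def PiE_iff)

lemma hc_codeword_subset_placement:
  assumes d: "d \<in> demands (q * q) m" and u: "u < q * q" and a: "a \<in> slab q u"
  shows "hc_codeword q e d u a \<subseteq> {..<m} \<times> e ` slab q u"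
proof -
  have "a(i := (a i + u div q + (q - i)) mod q) \<in> slab q u" if "i < q" for i
  proof -
    \<comment> \<open>In the sender's own coordinate the shift is \<open>q\<close>, trivial modulo
      \<open>q\<close>; changing any other coordinate does not leave the slab.\<close>
    have "u div q + (q - u div q) = q"
      using u by (simp add: less_mult_imp_div_less less_imp_le)
    then have "(u mod q + u div q + (q - u div q)) mod q = u mod q"
      by (simp add: add.assoc)
    then show ?thesis
      using a that q_pos by (auto simp: slab_def cube_upd)
  qed
  moreover have "d (i * q + a i) < m" if "i < q" for i
    using a that by (intro demand_less[OF d] user_pair_less) (auto simp: slab_def cube_def)
  ultimately show ?thesis
    by (auto simp: hc_codeword_def)
qed

lemma set_hc_codewords:
  "set (codewords (hc_scheme m q e) u d) = hc_codeword q e d u ` slab q u"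
proof -
  have "inv_into (cube q) e (e a) = a" if "a \<in> slab q u" for a
    using that numbering by (simp add: slab_def bij_betw_def)
  then show ?thesis
    using finite_slab by (force simp: hc_scheme_def image_image)
qed

text \<open>Each cache holds \<open>m * q ^ (q - 1)\<close> packets, which is \<open>m / q\<close>
  times \<open>q ^ q\<close>; likewise \<open>q ^ (q - 1)\<close> codewords amount to rate
  \<open>1 / q\<close>.\<close>

lemma valid_hc_scheme:
  "valid_scheme (q * q) m (real m / real q) (q ^ q) F (hc_scheme m q e)"
proof -
  have pow: "real q ^ q = real q * real q ^ (q - 1)"
    using q_pos by (simp flip: power_Suc)
  have "e ` slab q u \<subseteq> {..<q ^ q}" for u
    using numbering by (auto simp: slab_def bij_betw_def)
  moreover have "length (codewords (hc_scheme m q e) u d) = q ^ (q - 1)" if "u < q * q" for u d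
    using that by (simp add: hc_scheme_def card_image_slab)
  ultimately show ?thesis
    using q_pos unfolding valid_scheme_def set_hc_codewords
    by (auto simp: hc_scheme_def card_cartesian_product card_image_slab pow
        dest: hc_codeword_subset_placement)
qed

text \<open>A wanted packet is either cached by \<open>u\<close> or the only summand not cached by
  \<open>u\<close> in some codeword of another user.\<close>

lemma decodable:
  assumes F: "q ^ q dvd F" and d: "d \<in> demands (q * q) m" and u: "u < q * q"
    and len: "\<And>f. f < m \<Longrightarrow> length (w f) = F" "\<And>f. f < m \<Longrightarrow> length (w' f) = F"
    and cache: "cache_content (q ^ q) F (hc_scheme m q e) w u =
                cache_content (q ^ q) F (hc_scheme m q e) w' u"
    and sent: "\<And>v. v < q * q \<Longrightarrow> v \<noteq> u \<Longrightarrow>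
      sent_message (q ^ q) F (hc_scheme m q e) d (cache_content (q ^ q) F (hc_scheme m q e) w v) v =
      sent_message (q ^ q) F (hc_scheme m q e) d (cache_content (q ^ q) F (hc_scheme m q e) w' v) v"
  shows "w (d u) = w' (d u)"
proof -
  let ?S = "hc_scheme m q e" and ?K = "q ^ q"
  define i c where "i = u div q" and "c = u mod q"
  have ic: "i < q" "c < q" and u_eq: "i * q + c = u"
    using u q_pos by (auto simp: i_def c_def less_mult_imp_div_less)
  have cached: "packet_of ?K F w p = packet_of ?K F w' p" if "p \<in> {..<m} \<times> e ` slab q u" for p
    using fun_cong[OF cache, of p] that by (simp add: cache_content_def hc_scheme_def)
  have packet: "packet_of ?K F w (d u, e x) = packet_of ?K F w' (d u, e x)" if x: "x \<in> cube q" for x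
  proof (cases "x i = c")
    case True
    then have "x \<in> slab q u"
      using x by (simp add: slab_def i_def c_def)
    then show ?thesis
      using demand_less[OF d u] by (intro cached) auto
  next
    case False
    have x_less: "x j < q" if "j < q" for j
      using x that by (auto simp: cube_def)
    \<comment> \<open>\<open>j\<close> solves \<open>c + j - i = x i\<close> modulo
      \<open>q\<close>: in the group \<open>g\<close>, which contains \<open>u\<close>, member
      \<open>j\<close> sends the codeword that moves coordinate \<open>i\<close> from
      \<open>c\<close> to \<open>x i\<close>.\<close>
    define j where "j = (i + x i + (q - c)) mod q"
    define g where "g = x(i := c)"
    define v where "v = j * q + x j"
    have j: "j < q"
      using q_pos by (simp add: j_def)
    have "(c + j + (q - i)) mod q = (c + (i + x i + (q - c)) + (q - i)) mod q"
      unfolding j_def by (metis mod_add_left_eq mod_add_right_eq)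
    also have "c + (i + x i + (q - c)) + (q - i) = x i + q + q"
      using ic by simp
    finally have shift: "(c + j + (q - i)) mod q = x i"
      using x_less[OF ic(1)] by simp
    \<comment> \<open>\<open>j = i\<close> would mean a zero shift and hence
      \<open>x i = c\<close>.\<close>
    have "j \<noteq> i"
    proof
      assume "j = i"
      then have "c + j + (q - i) = c + q"
        using ic by simp
      then show False
        using shift ic False by simp
    qed
    have v: "v < q * q" "v div q = j" "v mod q = x j"
      using j x_less[OF j] by (auto simp: v_def user_pair_less)
    then have "v \<noteq> u"
      using \<open>j \<noteq> i\<close> by (auto simp: i_def)
    have g: "g \<in> slab q v"
      using x ic v \<open>j \<noteq> i\<close> by (simp add: slab_def g_def cube_upd)
    let ?A = "hc_codeword q e d v g" and ?p = "(d u, e x)"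
    let ?Z = "\<lambda>w. cache_content ?K F ?S w v"
    have p_in: "?p \<in> ?A"
      unfolding hc_codeword_def
      by (rule image_eqI[where x = i]) (use ic u_eq v shift in \<open>auto simp: g_def\<close>)
    have A_placed: "?A \<subseteq> placement ?S v"
      using hc_codeword_subset_placement[OF d v(1) g] by (simp add: hc_scheme_def)
    have Z: "the (?Z w y) = packet_of ?K F w y" if "y \<in> ?A" for w y
      using A_placed that by (auto simp: cache_content_def)
    have "?A \<in> set (codewords ?S v d)"
      using g by (simp add: set_hc_codewords)
    then have xor: "xor_packets (F div ?K) (?Z w) ?A = xor_packets (F div ?K) (?Z w') ?A"
      using sent[OF v(1) \<open>v \<noteq> u\<close>] by (simp add: sent_message_def)
    \<comment> \<open>The remaining summands alter a coordinate \<open>l\<close> other than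
      \<open>i\<close>, so coordinate \<open>i\<close> stays \<open>c\<close> and \<open>u\<close>
      has them cached.\<close>
    have others: "?Z w y = ?Z w' y" if y_in: "y \<in> ?A - {?p}" for y
    proof -
      obtain l where l: "l < q" and y:
        "y = (d (l * q + g l), e (g(l := (g l + v div q + (q - l)) mod q)))"
        using y_in unfolding hc_codeword_def by blast
      have "l \<noteq> i"
        using y_in y v shift u_eq by (auto simp: g_def)
      have "g \<in> cube q"
        using g by (simp add: slab_def)
      then have "g(l := (g l + v div q + (q - l)) mod q) \<in> slab q u"
        using l \<open>l \<noteq> i\<close> q_pos by (simp add: slab_def cube_upd i_def c_def) (simp add: g_def i_def c_def)
      moreover have "d (l * q + g l) < m"
        using l \<open>l \<noteq> i\<close> x_less by (intro demand_less[OF d] user_pair_less) (auto simp: g_def)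
      ultimately have "packet_of ?K F w y = packet_of ?K F w' y"
        unfolding y by (intro cached) auto
      then show ?thesis
        by (simp add: cache_content_def)
    qed
    have "e x < ?K"
      using numbering x by (auto simp: bij_betw_def)
    then have "the (?Z w ?p) = the (?Z w' ?p)"
      using F len demand_less[OF d u] p_in others xor
      by (intro xor_packets_determines_summand[where A = ?A and b = "F div ?K"])
        (auto simp: Z length_packet_of hc_codeword_def[of q e d v g])
    then show ?thesis
      using Z[OF p_in] by simp
  qed
  show ?thesis
  proof (rule file_eqI_packets[OF F])
    show "length (w (d u)) = F" "length (w' (d u)) = F"
      using len demand_less[OF d u] by auto
    fix k assume "k < ?K"
    then obtain x where "x \<in> cube q" "k = e x"
      using numbering by (auto simp: bij_betw_def)
    then show "packet_of ?K F w (d u, k) = packet_of ?K F w' (d u, k)"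
      using packet by simp
  qed
qed

text \<open>With all users in range, equal \<open>received\<close> maps mean equal messages from
  every other user, as \<open>decodable\<close> requires.\<close>

lemma estimate_hc_scheme:
  assumes "q ^ q dvd F" "d \<in> demands (q * q) m" "u < q * q" "\<forall>f<m. length (w f) = F"
    and hears: "\<And>v. v < q * q \<Longrightarrow> dist (pos u) (pos v) \<le> r"
  shows "estimate (q * q) pos r (q ^ q) F
           (with_consistent_decoder (q * q) pos r m (q ^ q) F (hc_scheme m q e)) d w u = w (d u)"
proof (rule estimate_with_consistent_decoder[OF assms(4)])
  fix w' :: "nat \<Rightarrow> bool list"
  let ?S = "hc_scheme m q e" and ?K = "q ^ q"
  assume w': "\<forall>f<m. length (w' f) = F"
    and cache: "cache_content ?K F ?S w' u = cache_content ?K F ?S w u"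
    and rec: "received (q * q) pos r ?K F ?S d w' u = received (q * q) pos r ?K F ?S d w u"
  show "w' (d u) = w (d u)"
  proof (rule decodable[OF assms(1-3) _ _ cache])
    fix v assume "v < q * q" "v \<noteq> u"
    then show "sent_message ?K F ?S d (cache_content ?K F ?S w' v) v =
        sent_message ?K F ?S d (cache_content ?K F ?S w v) v"
      using fun_cong[OF rec, of v] hears by (simp add: received_def)
  qed (use w' assms(4) in auto)
qed

end

section \<open>Achievability\<close>

lemma dist_unit_square_le:
  fixes x y :: "real \<times> real"
  assumes "x \<in> {0..1} \<times> {0..1}" "y \<in> {0..1} \<times> {0..1}"
  shows "dist x y \<le> sqrt 2"
proof -
  have "(dist (fst x) (fst y))\<^sup>2 \<le> 1\<^sup>2" "(dist (snd x) (snd y))\<^sup>2 \<le> 1\<^sup>2"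
    using assms by (intro power_mono; auto simp: dist_real_def mem_Times_iff)+
  then show ?thesis
    by (simp add: dist_prod_def)
qed

text \<open>A random variable into \<open>count_space (bit_strings F)\<close> takes values there at
  every outcome, not only almost surely.\<close>

lemma file_library_length:
  assumes "file_library m F P W" "f < m" "\<omega> \<in> space P"
  shows "length (W f \<omega>) = F"
proof -
  have P: "prob_space P"
    and indep: "prob_space.indep_vars P (\<lambda>_. count_space (bit_strings F)) W {..<m}"
    using assms(1) by (auto simp: file_library_def)
  have "W f \<in> measurable P (count_space (bit_strings F))"
    using indep assms(2) by (simp add: prob_space.indep_vars_def[OF P])
  from measurable_space[OF this assms(3)] show ?thesis
    by (simp add: bit_strings_def)
qed

lemma demands_nonempty:
  assumes "n \<le> m"
  shows "demands n m \<noteq> {}"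
proof -
  have "restrict id {..<n} \<in> demands n m"
    using assms by (auto simp: demands_def inj_on_def)
  then show ?thesis
    by blast
qed

text \<open>Every failure event is empty, and both maxima run over nonempty index sets, so each set
  of values is \<open>{0}\<close>.\<close>

lemma error_prob_eq_0:
  assumes "n \<le> m" "0 < n"
    and "\<And>d u \<omega>. d \<in> demands n m \<Longrightarrow> u < n \<Longrightarrow> \<omega> \<in> space P \<Longrightarrow>
           estimate n pos r K F S d (\<lambda>f. W f \<omega>) u = W (d u) \<omega>"
  shows "error_prob P W n m pos r K F S = 0"
proof -
  have inner: "(MAX u\<in>{..<n}. measure P
      {\<omega> \<in> space P. estimate n pos r K F S d (\<lambda>f. W f \<omega>) u \<noteq> W (d u) \<omega>}) = 0"
    if d: "d \<in> demands n m" for d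
  proof -
    have "measure P {\<omega> \<in> space P. estimate n pos r K F S d (\<lambda>f. W f \<omega>) u \<noteq> W (d u) \<omega>} = 0"
      if "u \<in> {..<n}" for u
    proof -
      have "{\<omega> \<in> space P. estimate n pos r K F S d (\<lambda>f. W f \<omega>) u \<noteq> W (d u) \<omega>} = {}"
        using assms(3)[OF d] that by auto
      then show ?thesis by (simp only: measure_empty)
    qed
    then have "(\<lambda>u. measure P {\<omega> \<in> space P. estimate n pos r K F S d (\<lambda>f. W f \<omega>) u \<noteq> W (d u) \<omega>})
        ` {..<n} = {0}"
      using assms(2) by (auto simp: image_iff intro!: bexI[of _ 0])
    then show ?thesis by (simp only: Max_singleton)
  qed
  have "(\<lambda>d. MAX u\<in>{..<n}. measure P
      {\<omega> \<in> space P. estimate n pos r K F S d (\<lambda>f. W f \<omega>) u \<noteq> W (d u) \<omega>}) ` demands n m = {0}"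
    using demands_nonempty[OF assms(1)] inner by (auto simp: image_iff)
  then show ?thesis
    unfolding error_prob_def by (simp only: Max_singleton)
qed

theorem theorem1:
  fixes m n :: nat and M r t :: real
    and pos :: "nat \<Rightarrow> real \<times> real"
    and P :: "nat \<Rightarrow> 'w measure" and W :: "nat \<Rightarrow> nat \<Rightarrow> 'w \<Rightarrow> bool list"
  assumes "n \<le> m"
    and "uniform_grid n pos"
    and "\<And>F. file_library m F (P F) (W F)"
    and "t = real n * M / real m"
    and "r \<ge> sqrt 2"
    and "real n = (real m / M)^2"
    and "real m / M \<in> \<int>" and "real m / M > 0"
    and "t \<ge> 2"
  shows "\<exists>K::nat. real K = sqrt (real n) powr sqrt (real n) \<and>
           achievable P W n m pos r K M (real m / M)"
proof -
  obtain z where z: "real m / M = of_int z"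
    using assms(7) by (auto elim: Ints_cases)
  define q where "q = nat z"
  have q: "real m / M = real q" and q_pos: "0 < q"
    using z assms(8) by (auto simp: q_def)
  have "real n = real (q * q)"
    using assms(6) q by (simp add: power2_eq_square)
  then have n: "n = q * q"
    by (simp only: of_nat_eq_iff)
  \<comment> \<open>\<open>M = 0\<close> is excluded because division by zero would give
    \<open>real m / M = 0\<close>.\<close>
  have M: "M = real m / real q"
    using q q_pos assms(8) by (cases "M = 0") (auto simp: field_simps)
  obtain e where e: "bij_betw e (cube q) {..<q ^ q}"
    using finite_same_card_bij[of "cube q" "{..<q ^ q}"] by (auto simp: finite_cube card_cube)
  interpret hypercube q m e
    by unfold_locales (fact q_pos e)+
  define S where "S F = with_consistent_decoder (q * q) pos r m (q ^ q) F (hc_scheme m q e)" for F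
  have hears: "dist (pos u) (pos v) \<le> r" if "u < q * q" "v < q * q" for u v
  proof -
    have "pos u \<in> {0..1} \<times> {0..1}" "pos v \<in> {0..1} \<times> {0..1}"
      using assms(2) that n by (auto simp: uniform_grid_def)
    then show ?thesis
      by (rule order_trans[OF dist_unit_square_le assms(5)])
  qed
  have valid: "valid_scheme n m M (q ^ q) F (S F)" for F
    using valid_hc_scheme[of F] by (simp add: valid_scheme_def S_def n M)
  have rate: "total_rate n (S F) = real m / M" for F
    using q_pos by (simp add: total_rate_def S_def hc_scheme_def n q)
  have error: "error_prob (P F) (W F) n m pos r (q ^ q) F (S F) = 0" if "q ^ q dvd F" for F
    using that assms(1) q_pos hears file_library_length[OF assms(3)]
    by (intro error_prob_eq_0) (auto simp: S_def n intro!: estimate_hc_scheme)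
  have "achievable P W n m pos r (q ^ q) M (real m / M)"
    unfolding achievable_def
  proof (intro conjI allI impI exI[of _ S])
    fix \<epsilon> :: real assume "0 < \<epsilon>"
    then show "Limsup (file_sizes (q ^ q))
        (\<lambda>F. ereal (error_prob (P F) (W F) n m pos r (q ^ q) F (S F))) \<le> ereal \<epsilon>"
      \<comment> \<open>The principal part of the filter restricts \<open>F\<close> to multiples of
        \<open>q ^ q\<close>, where the error is zero.\<close>
      unfolding file_sizes_def
      by (intro Limsup_bounded) (simp add: eventually_inf_principal error)
    show "Limsup (file_sizes (q ^ q)) (\<lambda>F. ereal (total_rate n (S F))) \<le> ereal (real m / M)"
      by (intro Limsup_bounded) (simp add: rate)
  qed (use q_pos valid in auto)
  moreover have "real (q ^ q) = sqrt (real n) powr sqrt (real n)"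
    using q_pos by (simp add: n powr_realpow real_sqrt_mult)
  ultimately show ?thesis
    by blast
qed

end
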